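(* Let $n\ge 6$. The group $G_n$, which has order $\varphi(n)$, is the smallest group of permutations $\sigma_{\tau,n}$ whose action on $C_n$ gives the equivalence classes of $C_n$ under permutations which preserve rotation symmetry. That is: $|G_n|=\varphi(n)$, the orbits of $G_n$ on $C_n$ are exactly these equivalence classes, and no subgroup $H\subseteq G_n$ with $|H|<\varphi(n)$ has the property that its orbits on $C_n$ are exactly these equivalence classes.
   Context: A Boolean function in $n$ variables is written in algebraic normal form as a polynomial over $GF(2)$ in $x_1,\dots,x_n$; indices are read modulo $n$ in $\{1,\dots,n\}$. For an integer $a$, $a \text{ Mod } n$ denotes the unique $b\in\{1,\dots,n\}$ with $b\equiv a \pmod n$. A function is rotation symmetric if its algebraic normal form is unchanged by every cyclic shift of the variables. For pairwise distinct $1,j,k\in\{1,\dots,n\}$, the cubic monomial rotation symmetric (MRS) function $(1,j,k)$ is the sum of the distinct monomials among $x_{1+t}x_{j+t}x_{k+t}$, $t=0,\dots,n-1$. $C_n$ is the set of all cubic MRS functions in $n$ variables. A permutation $\sigma$ of $\{1,\dots,n\}$ acts on functions by replacing each $x_i$ by $x_{\sigma(i)}$. It preserves rotation symmetry if $\sigma(f)$ is rotation symmetric for every cubic MRS function $f$ in $n$ variables. Two functions $f,g\in C_n$ are equivalent under permutations which preserve rotation symmetry if $\sigma(f)=g$ for some such $\sigma$. For $\gcd(\tau,n)=1$, $\sigma_{\tau,n}$ is the permutation $\sigma_{\tau,n}(i)=(i-1)\tau+1 \text{ Mod } n$, $1\le i\le n$, and $G_n=\{\sigma_{\tau,n}:\gcd(\tau,n)=1\}$,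 a group under composition, acting on $C_n$ by $f\mapsto\sigma_{\tau,n}(f)$. $\varphi$ is Euler's function. *)

theory Defs
  imports
    "HOL-Library.Poly_Mapping"
    "HOL-Library.Z2"
    "HOL-Number_Theory.Number_Theory"
    "HOL-Algebra.Group_Action"
    "HOL-Algebra.Sym_Groups"
begin

text \<open>Polynomials over GF(2) in the variables \<open>x\<^sub>i\<close>: a monomial is its exponent map
  \<open>nat \<Rightarrow>\<^sub>0 nat\<close>. An algebraic normal form is such a polynomial that is squarefree in every
  variable, so that Boolean functions are equal iff these polynomials are.\<close>

type_synonym bpoly = "(nat \<Rightarrow>\<^sub>0 nat) \<Rightarrow>\<^sub>0 bit"

definition var :: "nat \<Rightarrow> bpoly" where
  "var i = Poly_Mapping.single (Poly_Mapping.single i 1) 1"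

definition is_anf :: "nat \<Rightarrow> bpoly \<Rightarrow> bool" where
  "is_anf n f \<longleftrightarrow> (\<forall>m \<in> Poly_Mapping.keys f.
     Poly_Mapping.keys m \<subseteq> {1..n} \<and> (\<forall>i. Poly_Mapping.lookup m i \<le> 1))"

text \<open>Replacing each \<open>x\<^sub>i\<close> by \<open>x\<^bsub>\<sigma>(i)\<^esub>\<close>, as a substitution of polynomials. On an algebraic
  normal form in the variables \<open>1..n\<close> and for \<open>\<sigma>\<close> a permutation of \<open>{1..n}\<close> the result is again
  squarefree, so no reduction modulo \<open>x\<^sub>i\<^sup>2 = x\<^sub>i\<close> is needed.\<close>

definition subst_vars :: "(nat \<Rightarrow> nat) \<Rightarrow> bpoly \<Rightarrow> bpoly" where
  "subst_vars \<sigma> f = (\<Sum>m \<in> Poly_Mapping.keys f.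
     Poly_Mapping.single 0 (Poly_Mapping.lookup f m) *
     (\<Prod>i \<in> Poly_Mapping.keys m. var (\<sigma> i) ^ Poly_Mapping.lookup m i))"

text \<open>\<open>a Mod n\<close>, the representative of \<open>a\<close> modulo \<open>n\<close> in \<open>{1..n}\<close> (not in \<open>{0..<n}\<close>).\<close>

definition Mod_rep :: "int \<Rightarrow> nat \<Rightarrow> nat"  (infixl \<open>Mod\<close> 70) where
  "a Mod n = nat ((a - 1) mod int n) + 1"

lemma Mod_rep_unique:
  assumes "n > 0"
  shows "b = a Mod n \<longleftrightarrow> b \<in> {1..n} \<and> [int b = a] (mod int n)"
proof
  have r: "0 \<le> (a - 1) mod int n" "(a - 1) mod int n < int n"
    using assms by simp_all
  show "b \<in> {1..n} \<and> [int b = a] (mod int n)" if "b = a Mod n"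
    using that r by (auto simp: Mod_rep_def cong_def nat_less_iff mod_add_right_eq Suc_le_eq)
  show "b = a Mod n" if b: "b \<in> {1..n} \<and> [int b = a] (mod int n)"
  proof -
    have "[int b - 1 = a - 1] (mod int n)"
      using b by (intro cong_diff) auto
    hence "(a - 1) mod int n = int b - 1"
      using b by (auto simp: cong_def)
    thus ?thesis using b by (auto simp: Mod_rep_def)
  qed
qed

text \<open>As for the library's \<open>permutes\<close>, permutations of \<open>{1..n}\<close> are the identity elsewhere.\<close>

definition cyclic_shift :: "nat \<Rightarrow> nat \<Rightarrow> nat \<Rightarrow> nat" where
  "cyclic_shift n t i = (if i \<in> {1..n} then int (i + t) Mod n else i)"

definition rotation_symmetric :: "nat \<Rightarrow> bpoly \<Rightarrow> bool" where
  "rotation_symmetric n f \<longleftrightarrow> is_anf n f \<and> (\<forall>t. subst_vars (cyclic_shift n t) f = f)"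

text \<open>Summing over the image set, not over \<open>t\<close>, counts coinciding monomials only once.\<close>

definition cubic_mrs :: "nat \<Rightarrow> nat \<Rightarrow> nat \<Rightarrow> bpoly" where
  "cubic_mrs n j k =
     (\<Sum>p \<in> (\<lambda>t. var (int (1 + t) Mod n) * var (int (j + t) Mod n)
                   * var (int (k + t) Mod n)) ` {0..<n}. p)"

definition cubic_mrs_set :: "nat \<Rightarrow> bpoly set" where
  "cubic_mrs_set n = {cubic_mrs n j k | j k.
     j \<in> {1..n} \<and> k \<in> {1..n} \<and> j \<noteq> 1 \<and> k \<noteq> 1 \<and> j \<noteq> k}"

definition preserves_rotation_symmetry :: "nat \<Rightarrow> (nat \<Rightarrow> nat) \<Rightarrow> bool" where
  "preserves_rotation_symmetry n \<sigma> \<longleftrightarrow>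
     \<sigma> permutes {1..n} \<and> (\<forall>f \<in> cubic_mrs_set n. rotation_symmetric n (subst_vars \<sigma> f))"

definition mrs_equivalence :: "nat \<Rightarrow> (bpoly \<times> bpoly) set" where
  "mrs_equivalence n = {(f, g). f \<in> cubic_mrs_set n \<and> g \<in> cubic_mrs_set n \<and>
     (\<exists>\<sigma>. preserves_rotation_symmetry n \<sigma> \<and> subst_vars \<sigma> f = g)}"

definition sigma_perm :: "int \<Rightarrow> nat \<Rightarrow> nat \<Rightarrow> nat" where
  "sigma_perm \<tau> n i = (if i \<in> {1..n} then ((int i - 1) * \<tau> + 1) Mod n else i)"

definition sigma_group :: "nat \<Rightarrow> (nat \<Rightarrow> nat) set" where
  "sigma_group n = {sigma_perm \<tau> n | \<tau>. coprime \<tau> (int n)}"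

definition mrs_orbits :: "nat \<Rightarrow> (nat \<Rightarrow> nat) set \<Rightarrow> bpoly set set" where
  "mrs_orbits n H = orbits ((sym_group n)\<lparr>carrier := H\<rparr>) (cubic_mrs_set n) subst_vars"

end

theory Submission
  imports Defs
begin

text \<open>Let \<open>T\<close> be the group of cyclic shifts and number the variables by residues modulo \<open>n\<close>. If \<open>\<sigma>\<close>
  preserves rotation symmetry, then \<open>\<rho> = \<sigma>\<^sup>-\<^sup>1 s \<sigma>\<close>, for \<open>s\<close> the unit shift, maps every \<open>T\<close>-orbit of
  triples to itself. Fixing the orbit of \<open>{0,1,2}\<close> makes \<open>\<rho>\<close> an automorphism of the \<open>n\<close>-cycle, and
  fixing the orbit of \<open>{0,1,3}\<close> rules out reflections, so \<open>\<rho>\<close> is a translation. Hence \<open>\<sigma>\<close> is affine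
  and acts on \<open>T\<close>-orbits as some \<open>\<sigma>\<^sub>\<tau>\<close>.

  For minimality, let a subgroup \<open>H\<close> have the same orbits, so that \<open>G\<^sub>n = H \<cdot> Stab(f)\<close> for all cubic \<open>f\<close>.
  The stabilizer of the orbit of \<open>{0,1,2}\<close> is \<open>{1,-1}\<close>, so if \<open>H\<close> is proper then \<open>-1 \<notin> H\<close>. Applied
  to \<open>{0,1,3}\<close>, the factorization of \<open>-1\<close> gives an element of its stabilizer outside \<open>H\<close>. That
  stabilizer has exponent 3 unless \<open>n = 8\<close>, and then the cube of the factor in \<open>H\<close> is \<open>-1\<close>, a
  contradiction; for \<open>n = 8\<close> the set \<open>{0,1,4}\<close> finishes the argument.\<close>

section \<open>Square-free polynomials as set families\<close>

definition monom_of :: "nat set \<Rightarrow> nat \<Rightarrow>\<^sub>0 nat" where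
  "monom_of S = (\<Sum>i\<in>S. Poly_Mapping.single i 1)"

text \<open>Over GF(2) a polynomial is determined by its support, so algebraic normal forms
  correspond to finite families of finite variable sets.\<close>

definition anf_of :: "nat set set \<Rightarrow> bpoly" where
  "anf_of F = (\<Sum>S\<in>F. Poly_Mapping.single (monom_of S) 1)"

lemma lookup_monom_of:
  assumes "finite S"
  shows "Poly_Mapping.lookup (monom_of S) i = (if i \<in> S then 1 else 0)"
  using assms by (simp add: monom_of_def lookup_sum lookup_single when_def sum.delta)

lemma keys_monom_of: "finite S \<Longrightarrow> Poly_Mapping.keys (monom_of S) = S"
  by (auto simp: in_keys_iff lookup_monom_of split: if_splits)

lemma inj_on_monom_of: "inj_on monom_of {S. finite S}"
  by (metis (mono_tags, lifting) inj_onI keys_monom_of mem_Collect_eq)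

lemma prod_var: "finite S \<Longrightarrow> (\<Prod>i\<in>S. var i) = Poly_Mapping.single (monom_of S) 1"
  by (induction S rule: finite_induct)
     (simp_all add: monom_of_def var_def mult_single single_one)

lemma lookup_anf_of:
  assumes "finite F" "F \<subseteq> {S. finite S}"
  shows "Poly_Mapping.lookup (anf_of F) m = (if m \<in> monom_of ` F then 1 else 0)"
proof -
  have "inj_on monom_of F"
    using inj_on_monom_of assms(2) by (rule inj_on_subset)
  then have "anf_of F = (\<Sum>m\<in>monom_of ` F. Poly_Mapping.single m 1)"
    by (simp add: anf_of_def sum.reindex)
  then show ?thesis
    using assms(1) by (simp add: lookup_sum lookup_single when_def sum.delta)
qed

lemma keys_anf_of:
  assumes "finite F" "F \<subseteq> {S. finite S}"
  shows "Poly_Mapping.keys (anf_of F) = monom_of ` F"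
  using assms by (auto simp: in_keys_iff lookup_anf_of split: if_splits)

lemma anf_of_eq_iff:
  assumes "finite F" "F \<subseteq> {S. finite S}" "finite F'" "F' \<subseteq> {S. finite S}"
  shows "anf_of F = anf_of F' \<longleftrightarrow> F = F'"
  using assms inj_on_image_eq_iff[OF inj_on_monom_of] keys_anf_of by metis

text \<open>Since \<open>\<sigma>\<close> is injective, square-free monomials stay square-free and
  distinct sets keep distinct images, so no terms cancel modulo 2.\<close>

lemma subst_vars_anf_of:
  assumes "finite F" "F \<subseteq> {S. finite S}" "inj \<sigma>"
  shows "subst_vars \<sigma> (anf_of F) = anf_of ((`) \<sigma> ` F)"
proof -
  have inj: "inj_on monom_of F"
    using inj_on_monom_of assms(2) by (rule inj_on_subset)
  have "subst_vars \<sigma> (anf_of F) = (\<Sum>S\<in>F. Poly_Mapping.single 0 (Poly_Mapping.lookup (anf_of F) (monom_of S)) *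
     (\<Prod>i \<in> Poly_Mapping.keys (monom_of S). var (\<sigma> i) ^ Poly_Mapping.lookup (monom_of S) i))"
    using assms inj by (simp add: subst_vars_def keys_anf_of sum.reindex)
  also have "\<dots> = (\<Sum>S\<in>F. Poly_Mapping.single (monom_of (\<sigma> ` S)) 1)"
  proof (rule sum.cong)
    fix S assume S: "S \<in> F"
    then have fin: "finite S"
      using assms by auto
    have "(\<Prod>i \<in> Poly_Mapping.keys (monom_of S). var (\<sigma> i) ^ Poly_Mapping.lookup (monom_of S) i)
      = (\<Prod>i\<in>S. var (\<sigma> i))"
      using fin by (intro prod.cong) (auto simp: keys_monom_of lookup_monom_of)
    also have "\<dots> = (\<Prod>i\<in>\<sigma> ` S. var i)"
      using assms(3) by (simp add: prod.reindex inj_on_subset)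
    finally show "Poly_Mapping.single 0 (Poly_Mapping.lookup (anf_of F) (monom_of S)) *
     (\<Prod>i \<in> Poly_Mapping.keys (monom_of S). var (\<sigma> i) ^ Poly_Mapping.lookup (monom_of S) i)
      = Poly_Mapping.single (monom_of (\<sigma> ` S)) 1"
      using fin S assms by (simp add: prod_var lookup_anf_of)
  qed simp
  also have "\<dots> = anf_of ((`) \<sigma> ` F)"
    using assms(3) by (simp add: anf_of_def sum.reindex inj_on_def inj_image_eq_iff)
  finally show ?thesis .
qed

section \<open>Translation orbits\<close>

text \<open>Numbering \<open>{1..n}\<close> from \<open>0\<close> turns \<open>\<sigma>\<^sub>\<tau>\<close> into multiplication by \<open>\<tau>\<close>.\<close>

definition pos :: "nat \<Rightarrow> int \<Rightarrow> nat" where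
  "pos n x = (x + 1) Mod n"

lemma pos_in: "n > 0 \<Longrightarrow> pos n x \<in> {1..n}"
  by (metis Mod_rep_unique pos_def)

lemma pos_eq_iff: "n > 0 \<Longrightarrow> pos n x = pos n y \<longleftrightarrow> [x = y] (mod int n)"
  by (simp add: pos_def Mod_rep_def cong_def nat_eq_iff)

lemma pos_of_nat: "i \<in> {1..n} \<Longrightarrow> pos n (int i - 1) = i"
  by (auto simp: pos_def Mod_rep_def)

lemma ex_pos:
  assumes "i \<in> {1..n}"
  obtains x where "i = pos n x"
  using pos_of_nat[OF assms] by metis

lemma int_pos: "n > 0 \<Longrightarrow> int (pos n x) = x mod int n + 1"
  by (simp add: pos_def Mod_rep_def)

lemma cyclic_shift_pos:
  assumes "n > 0"
  shows "cyclic_shift n t (pos n x) = pos n (x + int t)"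
proof -
  have "[int (pos n x) + int t = x + int t + 1] (mod int n)"
    using mod_add_left_eq[of x "int n" "int t + 1"] assms
    by (simp add: int_pos cong_def algebra_simps)
  then have "int (pos n x + t) Mod n = (x + int t + 1) Mod n"
    by (simp add: Mod_rep_def cong_def mod_diff_cong)
  then show ?thesis
    using pos_in[OF assms, of x] unfolding cyclic_shift_def pos_def by simp
qed

lemma sigma_perm_pos:
  assumes "n > 0"
  shows "sigma_perm \<tau> n (pos n x) = pos n (\<tau> * x)"
  using pos_in[OF assms, of x] assms
  by (simp add: sigma_perm_def int_pos Mod_rep_def pos_def[of n "\<tau> * x"] mod_simps mult.commute)

text \<open>An affine map with unit slope is injective on residues, hence bijective on the finite
  set \<open>{1..n}\<close>. Shifts are the case of slope 1, the maps \<open>sigma_perm\<close> the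
  case of offset 0.\<close>

lemma permutes_if_pos:
  assumes "n > 0" "\<And>i. i \<notin> {1..n} \<Longrightarrow> p i = i"
    and p: "\<And>x. p (pos n x) = pos n (\<tau> * x + b)" and "coprime \<tau> (int n)"
  shows "p permutes {1..n}"
proof (rule bij_imp_permutes)
  have "inj_on p {1..n}"
  proof (rule inj_onI)
    fix i j assume ij: "i \<in> {1..n}" "j \<in> {1..n}" "p i = p j"
    obtain x y where xy: "i = pos n x" "j = pos n y"
      using ij ex_pos by metis
    then have "[\<tau> * x + b = \<tau> * y + b] (mod int n)"
      using ij p assms(1) by (simp add: pos_eq_iff)
    then have "[x = y] (mod int n)"
      using assms(4) by (simp add: cong_add_rcancel cong_mult_lcancel)
    then show "i = j"
      using xy assms(1) by (simp add: pos_eq_iff)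
  qed
  moreover have "p ` {1..n} \<subseteq> {1..n}"
    using ex_pos p pos_in[OF assms(1)] by (metis image_subsetI)
  ultimately show "bij_betw p {1..n} {1..n}"
    by (simp add: bij_betw_def endo_inj_surj)
qed (use assms in auto)

lemma sigma_perm_permutes:
  "n > 0 \<Longrightarrow> coprime \<tau> (int n) \<Longrightarrow> sigma_perm \<tau> n permutes {1..n}"
  by (rule permutes_if_pos[of _ _ \<tau> 0]) (simp_all only: sigma_perm_pos, auto simp: sigma_perm_def)

lemma cyclic_shift_permutes: "n > 0 \<Longrightarrow> cyclic_shift n t permutes {1..n}"
  by (rule permutes_if_pos[of _ _ 1 "int t"]) (simp_all only: cyclic_shift_pos, auto simp: cyclic_shift_def)

text \<open>\<open>A\<close> holds integer representatives and \<open>t\<close> runs through all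
  integers, so that reparametrising an orbit needs no reduction modulo \<open>n\<close>.\<close>

definition trans_orbit :: "nat \<Rightarrow> int set \<Rightarrow> nat set set" where
  "trans_orbit n A = range (\<lambda>t. (\<lambda>x. pos n (x + t)) ` A)"

lemma trans_orbit_subset: "n > 0 \<Longrightarrow> trans_orbit n A \<subseteq> Pow {1..n}"
  using pos_in by (fastforce simp: trans_orbit_def)

lemma trans_orbit_finite:
  assumes "n > 0"
  shows "finite (trans_orbit n A)" "trans_orbit n A \<subseteq> {S. finite S}"
  using trans_orbit_subset[OF assms] finite_subset by (blast, blast)

lemma anf_of_trans_orbit_eq_iff:
  "n > 0 \<Longrightarrow> anf_of (trans_orbit n A) = anf_of (trans_orbit n B) \<longleftrightarrow> trans_orbit n A = trans_orbit n B"
  by (intro anf_of_eq_iff trans_orbit_finite)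

lemma subst_vars_trans_orbit:
  assumes "n > 0" "\<sigma> permutes {1..n}"
  shows "subst_vars \<sigma> (anf_of (trans_orbit n A)) = anf_of ((`) \<sigma> ` trans_orbit n A)"
  by (rule subst_vars_anf_of[OF trans_orbit_finite[OF assms(1)] permutes_inj[OF assms(2)]])

text \<open>The map carries translation by \<open>t\<close> to translation by
  \<open>\<tau> * t\<close>, and \<open>b\<close> is only one more translation. As
  \<open>\<tau>\<close> is a unit, every translate of the scaled set is reached.\<close>

lemma image_trans_orbit:
  assumes "n > 0" "\<And>x. p (pos n x) = pos n (\<tau> * x + b)" "coprime \<tau> (int n)"
  shows "(`) p ` trans_orbit n A = trans_orbit n ((*) \<tau> ` A)"
proof -
  have *: "p ` (\<lambda>x. pos n (x + t)) ` A = (\<lambda>x. pos n (x + (\<tau> * t + b))) ` (*) \<tau> ` A" for t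
    by (simp add: image_image assms(2) algebra_simps)
  obtain \<kappa> where \<kappa>: "[\<tau> * \<kappa> = 1] (mod int n)"
    using assms(3) cong_solve_coprime_int by blast
  \<comment> \<open>The shift of \<open>A\<close> is the solution \<open>t'\<close> of
    \<open>\<tau> * t' + b = t\<close> modulo \<open>n\<close>.\<close>
  have **: "(\<lambda>x. pos n (x + t)) ` (*) \<tau> ` A = p ` (\<lambda>x. pos n (x + \<kappa> * (t - b))) ` A" for t
  proof -
    have "[\<tau> * (\<kappa> * (t - b)) + b = t] (mod int n)"
      using cong_add[OF cong_mult[OF \<kappa> cong_refl[of "t - b"]] cong_refl[of b]]
      by (simp add: algebra_simps)
    then have "pos n (x + t) = pos n (x + (\<tau> * (\<kappa> * (t - b)) + b))" for x
      using assms(1) by (simp add: pos_eq_iff cong_add_lcancel cong_sym_eq)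
    then show ?thesis
      using * by simp
  qed
  show ?thesis
  proof (intro subset_antisym subsetI)
    fix S assume "S \<in> (`) p ` trans_orbit n A"
    then show "S \<in> trans_orbit n ((*) \<tau> ` A)"
      unfolding trans_orbit_def using * by blast
  next
    fix S assume "S \<in> trans_orbit n ((*) \<tau> ` A)"
    then show "S \<in> (`) p ` trans_orbit n A"
      unfolding trans_orbit_def using ** by blast
  qed
qed

text \<open>Only the slope of an affine permutation acts on orbit sums, so a permutation preserving
  rotation symmetry can be replaced by some \<open>sigma_perm\<close> once it is known to be
  affine.\<close>

lemma subst_vars_affine:
  assumes "n > 0" "\<sigma> permutes {1..n}" "\<And>x. \<sigma> (pos n x) = pos n (\<tau> * x + b)" "coprime \<tau> (int n)"
  shows "subst_vars \<sigma> (anf_of (trans_orbit n A)) = anf_of (trans_orbit n ((*) \<tau> ` A))"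
  using assms by (simp add: subst_vars_trans_orbit image_trans_orbit)

lemma subst_sigma_perm:
  "n > 0 \<Longrightarrow> coprime \<tau> (int n) \<Longrightarrow>
    subst_vars (sigma_perm \<tau> n) (anf_of (trans_orbit n A)) = anf_of (trans_orbit n ((*) \<tau> ` A))"
  by (rule subst_vars_affine[where b = 0, OF _ sigma_perm_permutes]) (simp_all add: sigma_perm_pos)

lemma rotation_symmetric_trans_orbit:
  assumes "n > 0"
  shows "rotation_symmetric n (anf_of (trans_orbit n A))"
  unfolding rotation_symmetric_def
proof
  show "is_anf n (anf_of (trans_orbit n A))"
    using trans_orbit_subset[OF assms, of A] trans_orbit_finite[OF assms, of A]
    by (auto simp: is_anf_def keys_anf_of keys_monom_of lookup_monom_of subset_iff)
  show "\<forall>t. subst_vars (cyclic_shift n t) (anf_of (trans_orbit n A)) = anf_of (trans_orbit n A)"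
    using subst_vars_affine[OF assms cyclic_shift_permutes[OF assms], of _ 1]
    by (simp add: cyclic_shift_pos[OF assms])
qed

section \<open>Cubic MRS functions as sums over translation orbits\<close>

text \<open>Pairwise incongruence of \<open>0\<close>, \<open>a\<close>, \<open>b\<close> makes
  every monomial a product of three different variables. Both sides sum over a set, so orbits with
  fewer than \<open>n\<close> members are counted alike.\<close>

lemma cubic_mrs_eq:
  assumes "n > 0" "\<not> [a = 0] (mod int n)" "\<not> [b = 0] (mod int n)" "\<not> [a = b] (mod int n)"
  shows "cubic_mrs n (pos n a) (pos n b) = anf_of (trans_orbit n {0, a, b})"
proof -
  define T where "T t = (\<lambda>x. pos n (x + t)) ` {0, a, b}" for t
  have Mod: "int (pos n x + t) Mod n = pos n (x + int t)" for x t
    using cyclic_shift_pos[OF assms(1), of t x] pos_in[OF assms(1), of x]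
    by (simp add: cyclic_shift_def)
  have one: "int (1 + t) Mod n = pos n (0 + int t)" for t
    by (simp add: pos_def add.commute)
  have var: "var (int (1 + t) Mod n) * var (int (pos n a + t) Mod n) * var (int (pos n b + t) Mod n)
    = Poly_Mapping.single (monom_of (T (int t))) 1" for t
  proof -
    have "pos n (int t) \<noteq> pos n (a + int t)" "pos n (int t) \<noteq> pos n (b + int t)"
      "pos n (a + int t) \<noteq> pos n (b + int t)"
      using assms cong_add_rcancel[of 0 "int t" a] cong_add_rcancel[of 0 "int t" b]
      by (auto simp: pos_eq_iff cong_add_rcancel cong_sym_eq)
    then have "(\<Prod>i\<in>T (int t). var i) = var (pos n (int t)) * var (pos n (a + int t)) * var (pos n (b + int t))"
      by (simp add: T_def mult.assoc)
    then show ?thesis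
      unfolding Mod one by (simp add: T_def flip: prod_var)
  qed
  \<comment> \<open>The shifts below \<open>n\<close> represent all residues, hence give the whole
    orbit.\<close>
  have "(\<lambda>t. T (int t)) ` {0..<n} = range T"
  proof -
    have "T t = T (int (nat (t mod int n)))" for t
      unfolding T_def using assms(1)
      by (intro image_cong) (auto simp: pos_eq_iff cong_def mod_simps)
    moreover have "nat (t mod int n) \<in> {0..<n}" for t
      using assms(1) by (simp add: nat_less_iff)
    ultimately show ?thesis by blast
  qed
  then have *: "(\<lambda>t. T (int t)) ` {0..<n} = trans_orbit n {0, a, b}"
    by (simp add: trans_orbit_def T_def)
  have "cubic_mrs n (pos n a) (pos n b) =
    (\<Sum>p\<in>(\<lambda>S. Poly_Mapping.single (monom_of S) 1) ` trans_orbit n {0, a, b}. p)"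
    unfolding cubic_mrs_def var *[symmetric] by (simp add: image_image)
  also have "\<dots> = anf_of (trans_orbit n {0, a, b})"
    unfolding anf_of_def
  proof (subst sum.reindex)
    show "inj_on (\<lambda>S. Poly_Mapping.single (monom_of S) (1::bit)) (trans_orbit n {0, a, b})"
    proof (rule inj_onI)
      fix S S' assume S: "S \<in> trans_orbit n {0, a, b}" "S' \<in> trans_orbit n {0, a, b}"
        "Poly_Mapping.single (monom_of S) (1::bit) = Poly_Mapping.single (monom_of S') 1"
      then have "monom_of S = monom_of S'"
        by (metis keys_single singleton_inject zero_neq_one)
      then show "S = S'"
        using S trans_orbit_finite[OF assms(1)] inj_onD[OF inj_on_monom_of] by blast
    qed
  qed simp
  finally show ?thesis .
qed

lemma cubic_mrs_set_eq:
  assumes "n > 0"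
  shows "cubic_mrs_set n = {anf_of (trans_orbit n {0, a, b}) | a b.
    \<not> [a = 0] (mod int n) \<and> \<not> [b = 0] (mod int n) \<and> \<not> [a = b] (mod int n)}" (is "_ = ?R")
proof -
  have one: "pos n 0 = 1"
    by (simp add: pos_def Mod_rep_def)
  show ?thesis
  proof (intro subset_antisym subsetI)
    fix f assume "f \<in> cubic_mrs_set n"
    then obtain j k where jk: "f = cubic_mrs n j k" "j \<in> {1..n}" "k \<in> {1..n}" "j \<noteq> 1" "k \<noteq> 1" "j \<noteq> k"
      by (auto simp: cubic_mrs_set_def)
    obtain a b where ab: "j = pos n a" "k = pos n b"
      using jk ex_pos by metis
    have "\<not> [a = 0] (mod int n)" "\<not> [b = 0] (mod int n)" "\<not> [a = b] (mod int n)"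
      using jk ab one assms by (metis pos_eq_iff)+
    then show "f \<in> ?R"
      using jk ab cubic_mrs_eq[OF assms] by blast
  next
    fix f assume "f \<in> ?R"
    then obtain a b where ab: "f = anf_of (trans_orbit n {0, a, b})"
      "\<not> [a = 0] (mod int n)" "\<not> [b = 0] (mod int n)" "\<not> [a = b] (mod int n)" by blast
    then show "f \<in> cubic_mrs_set n"
      unfolding cubic_mrs_set_def using cubic_mrs_eq[OF assms ab(2-4)] pos_in[OF assms] one
      by (smt (verit, best) mem_Collect_eq pos_eq_iff[OF assms])
  qed
qed

lemma trans_orbit_self: "pos n ` A \<in> trans_orbit n A"
  unfolding trans_orbit_def by (rule range_eqI[of _ _ 0]) simp

section \<open>Stabilizers of the orbits of 012, 013 and 014\<close>

text \<open>Elimination by certificate: \<open>x\<close> and \<open>y\<close> are the multipliers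
  that cancel the unknown from two congruences.\<close>

lemma dvd_lin: "d dvd a \<Longrightarrow> d dvd b \<Longrightarrow> c = x * a + y * b \<Longrightarrow> d dvd (c::int)"
  by simp

text \<open>Eliminations often end in a small constant, which is nonzero modulo \<open>n\<close>;
  this excludes the case at hand.\<close>

lemma not_dvd_small: "n \<ge> 6 \<Longrightarrow> 0 < c \<Longrightarrow> c < 6 \<Longrightarrow> \<not> int n dvd c"
  by (auto dest!: zdvd_imp_le)

lemma pos_eq_iff_dvd: "n > 0 \<Longrightarrow> pos n x = pos n y \<longleftrightarrow> int n dvd x - y"
  by (simp add: pos_eq_iff cong_iff_dvd_diff)

lemma insert3_eq_cases:
  assumes "{x, y, z} = {u, v, w}" "x \<noteq> y" "x \<noteq> z" "y \<noteq> z"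
  shows "x = u \<and> y = v \<and> z = w \<or> x = u \<and> y = w \<and> z = v \<or> x = v \<and> y = u \<and> z = w \<or>
    x = v \<and> y = w \<and> z = u \<or> x = w \<and> y = u \<and> z = v \<or> x = w \<and> y = v \<and> z = u"
  using assms by (smt (verit) insert_iff singleton_iff)

text \<open>The six cases are the matchings of \<open>x\<close>, \<open>y\<close>, \<open>z\<close>
  with a translate of \<open>0\<close>, \<open>a\<close>, \<open>b\<close>. The element matched with
  the translate of \<open>0\<close> fixes the shift, and subtracting it leaves two
  congruences.\<close>

lemma trans_orbit_cases:
  assumes n: "n > 0" and mem: "pos n ` {x, y, z} \<in> trans_orbit n {0, a, b}"
    and dist: "\<not> int n dvd x - y" "\<not> int n dvd x - z" "\<not> int n dvd y - z"
  obtains "int n dvd y - x - a" "int n dvd z - x - b"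
  | "int n dvd z - x - a" "int n dvd y - x - b"
  | "int n dvd x - y - a" "int n dvd z - y - b"
  | "int n dvd z - y - a" "int n dvd x - y - b"
  | "int n dvd x - z - a" "int n dvd y - z - b"
  | "int n dvd y - z - a" "int n dvd x - z - b"
proof -
  obtain t where t: "{pos n x, pos n y, pos n z} = {pos n t, pos n (a + t), pos n (b + t)}"
    using mem by (auto simp: trans_orbit_def)
  have *: "int n dvd q - p - c" if "pos n p = pos n t" "pos n q = pos n (c + t)" for p q c
    using that dvd_lin[of "int n" "q - (c + t)" "p - t" "q - p - c" 1 "-1"] n
    by (simp add: pos_eq_iff_dvd)
  have "pos n x \<noteq> pos n y" "pos n x \<noteq> pos n z" "pos n y \<noteq> pos n z"
    using dist n by (simp_all add: pos_eq_iff_dvd)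
  with insert3_eq_cases[OF t] show ?thesis
    using * that by metis
qed

lemma coprime_not_dvd_mult:
  assumes "coprime \<kappa> (int n)" "\<not> int n dvd c"
  shows "\<not> int n dvd c * \<kappa>"
  using assms coprime_dvd_mult_left_iff[of "int n" \<kappa> c] coprime_commute by blast

text \<open>If \<open>\<kappa>\<close> fixes the orbit, then
  \<open>{0, \<kappa> * a, \<kappa> * b}\<close> is a translate of \<open>{0, a, b}\<close> modulo
  \<open>n\<close>, with distinct residues because \<open>\<kappa>\<close> is a unit. Each matching
  is a linear system in \<open>\<kappa>\<close>.\<close>

lemma stabilizer_cases:
  assumes n: "n > 0" and \<kappa>: "coprime \<kappa> (int n)"
    and ab: "\<not> int n dvd a" "\<not> int n dvd b" "\<not> int n dvd b - a"
    and eq: "trans_orbit n ((*) \<kappa> ` {0, a, b}) = trans_orbit n {0, a, b}"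
  obtains "int n dvd \<kappa> * a - a" "int n dvd \<kappa> * b - b"
  | "int n dvd \<kappa> * b - a" "int n dvd \<kappa> * a - b"
  | "int n dvd - (\<kappa> * a) - a" "int n dvd \<kappa> * b - \<kappa> * a - b"
  | "int n dvd \<kappa> * b - \<kappa> * a - a" "int n dvd - (\<kappa> * a) - b"
  | "int n dvd - (\<kappa> * b) - a" "int n dvd \<kappa> * a - \<kappa> * b - b"
  | "int n dvd \<kappa> * a - \<kappa> * b - a" "int n dvd - (\<kappa> * b) - b"
proof -
  have mem: "pos n ` {0, \<kappa> * a, \<kappa> * b} \<in> trans_orbit n {0, a, b}"
    using trans_orbit_self[of n "(*) \<kappa> ` {0, a, b}"] eq by simp
  have a: "\<not> int n dvd 0 - \<kappa> * a"
    using coprime_not_dvd_mult[OF \<kappa> ab(1)] by (simp add: mult.commute)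
  have b: "\<not> int n dvd 0 - \<kappa> * b"
    using coprime_not_dvd_mult[OF \<kappa> ab(2)] by (simp add: mult.commute)
  have "\<not> int n dvd \<kappa> * b - \<kappa> * a"
    using coprime_not_dvd_mult[OF \<kappa> ab(3)] by (simp add: algebra_simps)
  then have c: "\<not> int n dvd \<kappa> * a - \<kappa> * b"
    by (simp add: dvd_diff_commute)
  show thesis
    by (rule trans_orbit_cases[OF n mem a b c, unfolded diff_0 diff_0_right]) (rule that; assumption)+
qed

text \<open>Four of the six systems give \<open>1\<close> or \<open>-1\<close>; the other two
  eliminate to \<open>n\<close> dividing 3.\<close>

lemma stabilizer_012:
  assumes n: "n \<ge> 6" and \<kappa>: "coprime \<kappa> (int n)"
    and eq: "trans_orbit n ((*) \<kappa> ` {0, 1, 2}) = trans_orbit n {0, 1, 2}"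
  shows "[\<kappa> = 1] (mod int n) \<or> [\<kappa> = -1] (mod int n)"
proof -
  have no: "\<not> int n dvd 1" "\<not> int n dvd 2" "\<not> int n dvd 3"
    by (rule not_dvd_small[OF n]; simp)+
  have "int n dvd \<kappa> - 1 \<or> int n dvd \<kappa> + 1"
  proof (rule stabilizer_cases[OF _ \<kappa> _ _ _ eq])
    assume "int n dvd \<kappa> * 2 - 1" "int n dvd \<kappa> * 1 - 2"
    then have "int n dvd 3" by (rule dvd_lin[where x = 1 and y = "-2"]) simp
    then show ?thesis using no by simp
  next
    assume "int n dvd - (\<kappa> * 1) - 1"
    then have "int n dvd \<kappa> + 1" using dvd_minus_iff[of "int n" "\<kappa> + 1"] by simp
    then show ?thesis by simp
  next
    assume "int n dvd - (\<kappa> * 2) - 1" "int n dvd \<kappa> * 1 - \<kappa> * 2 - 2"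
    then have "int n dvd 3" by (rule dvd_lin[where x = 1 and y = "-2"]) simp
    then show ?thesis using no by simp
  next
    assume "int n dvd \<kappa> * 1 - \<kappa> * 2 - 1"
    then have "int n dvd \<kappa> + 1" using dvd_minus_iff[of "int n" "\<kappa> + 1"] by simp
    then show ?thesis by simp
  qed (use n no in simp_all)
  then show ?thesis
    by (simp add: cong_iff_dvd_diff)
qed

lemma dvd_prime_eq:
  assumes "int n dvd int p" "prime p" "n \<ge> 6" shows "n = p"
  using assms by (auto simp: prime_nat_iff)

text \<open>Apart from the identity, systems survive only for \<open>n = 7\<close>, with
  \<open>\<kappa>\<close> congruent to 2 or 4, and for \<open>n = 8\<close>, with 3; the rest make
  \<open>n\<close> divide 3 or 5. The last alternative is a cube because the minimality argument
  takes cubes.\<close>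

lemma stabilizer_013:
  assumes n: "n \<ge> 6" and \<kappa>: "coprime \<kappa> (int n)"
    and eq: "trans_orbit n ((*) \<kappa> ` {0, 1, 3}) = trans_orbit n {0, 1, 3}"
  shows "[\<kappa> = 1] (mod int n) \<or> n = 8 \<and> [\<kappa> = 3] (mod 8) \<or> [\<kappa> ^ 3 = 1] (mod int n)"
proof -
  have no: "\<not> int n dvd 1" "\<not> int n dvd 2" "\<not> int n dvd 3" "\<not> int n dvd 5"
    by (rule not_dvd_small[OF n]; simp)+
  have "prime (7::nat)" by simp
  then have n7: "n = 7" if "int n dvd 7"
    using that n dvd_prime_eq[of n 7] by simp
  \<comment> \<open>2 and 4 are the elements of order 3 modulo 7.\<close>
  have cube: "[\<kappa> ^ 3 = 1] (mod int n)" if "n = 7" "\<kappa> mod 7 = 2 \<or> \<kappa> mod 7 = 4"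
  proof -
    have "\<kappa> ^ 3 mod 7 = (\<kappa> mod 7) ^ 3 mod 7"
      by (simp add: power_mod)
    then show ?thesis
      using that by (auto simp: cong_def)
  qed
  show ?thesis
  proof (rule stabilizer_cases[OF _ \<kappa> _ _ _ eq])
    assume "int n dvd \<kappa> * 1 - 1"
    then show ?thesis by (simp add: cong_iff_dvd_diff)
  next
    assume *: "int n dvd \<kappa> * 3 - 1" "int n dvd \<kappa> * 1 - 3"
    then have "int n dvd 8" by (rule dvd_lin[where x = 1 and y = "-3"]) simp
    then have "n dvd 8" by presburger
    then have "n = 6 \<or> n = 7 \<or> n = 8"
      using n dvd_imp_le[of n 8] by auto
    then have "n = 8" using \<open>n dvd 8\<close> by auto
    then show ?thesis using * by (simp add: cong_iff_dvd_diff)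
  next
    assume "int n dvd - (\<kappa> * 1) - 1" "int n dvd \<kappa> * 3 - \<kappa> * 1 - 3"
    then have "int n dvd 5" by (rule dvd_lin[where x = "-2" and y = "-1"]) simp
    then show ?thesis using no by simp
  next
    assume *: "int n dvd \<kappa> * 3 - \<kappa> * 1 - 1" "int n dvd - (\<kappa> * 1) - 3"
    then have "int n dvd 7" by (rule dvd_lin[where x = "-1" and y = "-2"]) simp
    then have "n = 7" by (rule n7)
    moreover have "\<kappa> mod 7 = 4" using * \<open>n = 7\<close> by simp presburger
    ultimately show ?thesis using cube by blast
  next
    assume *: "int n dvd - (\<kappa> * 3) - 1" "int n dvd \<kappa> * 1 - \<kappa> * 3 - 3"
    then have "int n dvd 7" by (rule dvd_lin[where x = 2 and y = "-3"]) simp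
    then have "n = 7" by (rule n7)
    moreover have "\<kappa> mod 7 = 2" using * \<open>n = 7\<close> by simp presburger
    ultimately show ?thesis using cube by blast
  next
    assume "int n dvd \<kappa> * 1 - \<kappa> * 3 - 1" "int n dvd - (\<kappa> * 3) - 3"
    then have "int n dvd 3" by (rule dvd_lin[where x = 3 and y = "-2"]) simp
    then show ?thesis using no by simp
  qed (use n no in simp_all)
qed

text \<open>This settles \<open>n = 8\<close>, where the orbit of \<open>{0, 1, 3}\<close> leaves 3
  as a possible stabilizer element: here only 1 and 5 remain, and 5 will be forced into the
  subgroup.\<close>

lemma stabilizer_014:
  assumes \<kappa>: "coprime \<kappa> 8"
    and eq: "trans_orbit 8 ((*) \<kappa> ` {0, 1, 4}) = trans_orbit 8 {0, 1, 4}"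
  shows "[\<kappa> = 1] (mod 8) \<or> [\<kappa> = 5] (mod 8)"
proof -
  have "coprime \<kappa> (int 8)"
    using \<kappa> by simp
  then have "8 dvd \<kappa> - 1 \<or> 8 dvd \<kappa> - 5"
    by (rule stabilizer_cases[OF _ _ _ _ _ eq, rotated])
      ((simp; fail) | (simp, presburger))+
  then show ?thesis
    by (simp add: cong_iff_dvd_diff)
qed

section \<open>Permutations preserving rotation symmetry are affine\<close>

text \<open>Two members of a block of three consecutive residues are neighbours, or they are its
  ends and \<open>x\<close> is the midpoint.\<close>

lemma consecutive_cases:
  assumes n: "n > 0" and mem: "pos n ` {p, q, x} \<in> trans_orbit n {0, 1, 2}"
    and dist: "\<not> int n dvd p - q" "\<not> int n dvd p - x" "\<not> int n dvd q - x"
  obtains "int n dvd q - p - 1" | "int n dvd q - p + 1"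
    | "int n dvd q - p - 2" "int n dvd x - p - 1"
    | "int n dvd q - p + 2" "int n dvd x - p + 1"
proof (rule trans_orbit_cases[OF n mem dist])
  assume "int n dvd p - q - 1"
  then have "int n dvd q - p + 1"
    using dvd_minus_iff[of "int n" "q - p + 1"] by simp
  then show ?thesis by fact
next
  assume *: "int n dvd x - q - 1" "int n dvd p - q - 2"
  then have "int n dvd x - p + 1"
    by (rule dvd_lin[where x = 1 and y = "-1"]) simp
  moreover have "int n dvd q - p + 2"
    using * dvd_minus_iff[of "int n" "q - p + 2"] by simp
  ultimately show ?thesis using that by blast
next
  assume "int n dvd p - x - 1" "int n dvd q - x - 2"
  then have "int n dvd q - p - 1"
    by (rule dvd_lin[where x = "-1" and y = 1]) simp
  then show ?thesis by fact
next
  assume "int n dvd q - x - 1" "int n dvd p - x - 2"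
  then have "int n dvd q - p + 1"
    by (rule dvd_lin[where x = 1 and y = "-1"]) simp
  then show ?thesis by fact
qed (use that in blast)+

text \<open>Here \<open>r\<close> is an integer lift of an injective map on residues. Modulo
  \<open>n\<close> its steps are \<open>1\<close> or \<open>-1\<close> and successive steps agree,
  so it is linear with one of these slopes.\<close>

lemma translation_if_preserves_012_013:
  fixes r :: "int \<Rightarrow> int"
  assumes n: "n \<ge> 6" and inj: "\<And>x y. int n dvd r x - r y \<longleftrightarrow> int n dvd x - y"
    and 012: "\<And>t. pos n ` {r t, r (t + 1), r (t + 2)} \<in> trans_orbit n {0, 1, 2}"
    and 013: "pos n ` {r 0, r 1, r 3} \<in> trans_orbit n {0, 1, 3}"
  shows "int n dvd r x - (r 0 + x)"
proof -
  have no: "\<not> int n dvd 1" "\<not> int n dvd 2" "\<not> int n dvd 3" "\<not> int n dvd 4" "\<not> int n dvd 5"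
    by (rule not_dvd_small[OF n]; simp)+
  have n0: "n > 0" using n by simp
  have adjacent: "int n dvd r (t + 1) - r t - 1 \<or> int n dvd r (t + 1) - r t + 1" (is ?P) for t
  proof (rule ccontr)
    assume not: "\<not> ?P"
    text \<open>Otherwise both \<open>r (t - 1)\<close> and \<open>r (t + 2)\<close> lie midway between \<open>r t\<close> and \<open>r (t + 1)\<close>.\<close>
    have 1: "int n dvd r (t + 1) - r t - 2 \<and> int n dvd r (t + 2) - r t - 1 \<or>
      int n dvd r (t + 1) - r t + 2 \<and> int n dvd r (t + 2) - r t + 1"
      by (rule consecutive_cases[OF n0 012[of t]]) (use inj no not in auto)
    have "pos n ` {r t, r (t + 1), r (t - 1)} \<in> trans_orbit n {0, 1, 2}"
      using 012[of "t - 1"] by (simp add: insert_commute add.commute)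
    then have 2: "int n dvd r (t + 1) - r t - 2 \<and> int n dvd r (t - 1) - r t - 1 \<or>
      int n dvd r (t + 1) - r t + 2 \<and> int n dvd r (t - 1) - r t + 1"
      by (rule consecutive_cases[OF n0]) (use inj no not in auto)
    \<comment> \<open>As 4 is nonzero modulo \<open>n\<close>, both alternatives choose the same
      side, so the two midpoints coincide although \<open>t + 2\<close> and \<open>t - 1\<close>
      differ by 3.\<close>
    have "\<not> (int n dvd r (t + 1) - r t - 2 \<and> int n dvd r (t + 1) - r t + 2)"
      using no dvd_lin[of "int n" "r (t + 1) - r t - 2" "r (t + 1) - r t + 2" 4 "-1" 1] by auto
    then have "int n dvd r (t + 2) - r (t - 1)"
      using 1 2 dvd_lin[of "int n" "r (t + 2) - r t - 1" "r (t - 1) - r t - 1" "r (t + 2) - r (t - 1)" 1 "-1"]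
        dvd_lin[of "int n" "r (t + 2) - r t + 1" "r (t - 1) - r t + 1" "r (t + 2) - r (t - 1)" 1 "-1"]
      by auto
    then show False
      using inj no by simp
  qed
  \<comment> \<open>Two successive steps of opposite sign would lead back from \<open>r t\<close> to
    \<open>r (t + 2)\<close>, against injectivity.\<close>
  have same: "int n dvd r (t + 1) - r t - e \<longleftrightarrow> int n dvd r (t + 2) - r (t + 1) - e"
    if "e \<in> {1, -1}" for e t
  proof -
    have "\<not> int n dvd r (t + 2) - r t"
      using inj no by simp
    then have *: "\<not> (int n dvd r (t + 1) - r t - d \<and> int n dvd r (t + 2) - r (t + 1) + d)" for d
      using dvd_lin[of "int n" "r (t + 1) - r t - d" "r (t + 2) - r (t + 1) + d" "r (t + 2) - r t" 1 1]
      by auto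
    have eq: "t + 1 + 1 = t + 2" by simp
    show ?thesis
      using adjacent[of t] adjacent[of "t + 1", unfolded eq] *[of 1] *[of "-1"] that by auto
  qed
  have step: "int n dvd r (t + 1) - r t - e" if "e \<in> {1, -1}" "int n dvd r (0 + 1) - r 0 - e" for e t
  proof (induction t rule: int_induct[of _ 0])
    case base
    then show ?case using that(2) by simp
  next
    case (step1 i)
    then show ?case using same[OF that(1), of i] by (simp add: add.assoc)
  next
    case (step2 i)
    then show ?case using same[OF that(1), of "i - 1"] by (simp add: add.commute)
  qed
  have lin: "int n dvd r x - (r 0 + e * x)" if "e \<in> {1, -1}" "int n dvd r (0 + 1) - r 0 - e" for e x
  proof (induction x rule: int_induct[of _ 0])
    case base
    then show ?case by simp
  next
    case (step1 i)
    then show ?case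
      using dvd_lin[OF step1(2) step[OF that, of i], of "r (i + 1) - (r 0 + e * (i + 1))" 1 1]
      by (simp add: algebra_simps)
  next
    case (step2 i)
    then show ?case
      using dvd_lin[OF step2(2) step[OF that, of "i - 1"], of "r (i - 1) - (r 0 + e * (i - 1))" 1 "-1"]
      by (simp add: algebra_simps)
  qed
  \<comment> \<open>Slope \<open>-1\<close> would make \<open>{0, -1, -3}\<close> a translate of
    \<open>{0, 1, 3}\<close>, but their cyclic gaps 1, 2, \<open>n - 3\<close> come in opposite
    orders.\<close>
  have "\<not> int n dvd r (0 + 1) - r 0 + 1"
  proof
    assume "int n dvd r (0 + 1) - r 0 + 1"
    then have l: "int n dvd r x - (r 0 - x)" for x
      using lin[of "-1"] by simp
    have "pos n (r 1) = pos n (r 0 - 1)" "pos n (r 3) = pos n (r 0 - 3)"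
      using l[of 1] l[of 3] by (simp_all only: pos_eq_iff_dvd[OF n0])
    then have "pos n ` {r 0, r 0 - 1, r 0 - 3} \<in> trans_orbit n {0, 1, 3}"
      using 013 by simp
    then show False
      by (rule trans_orbit_cases[OF n0]) (use no in simp_all)
  qed
  then show ?thesis
    using adjacent[of 0] lin[of 1] by auto
qed

text \<open>Once \<open>\<rho>\<close> is translation by \<open>c\<close>, moving by
  \<open>c\<close> before \<open>\<sigma>\<close> equals moving by 1 after it. Iteration determines
  \<open>\<sigma>\<close> on the multiples of \<open>c\<close>, and \<open>c\<close> turns out to be
  a unit.\<close>

lemma preserves_imp_affine:
  assumes n: "n \<ge> 6" and pres: "preserves_rotation_symmetry n \<sigma>"
  obtains \<tau> b where "coprime \<tau> (int n)" "\<And>x. \<sigma> (pos n x) = pos n (\<tau> * x + b)"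
proof -
  have n0: "n > 0" using n by simp
  have perm: "\<sigma> permutes {1..n}"
    using pres by (simp add: preserves_rotation_symmetry_def)
  have inj: "inj \<sigma>" by (rule permutes_inj[OF perm])
  define s where "s = cyclic_shift n 1"
  have s: "s permutes {1..n}" "\<And>x. s (pos n x) = pos n (x + 1)"
    using n0 by (simp_all only: s_def cyclic_shift_permutes cyclic_shift_pos of_nat_1)
  define \<rho> where "\<rho> = inv_into UNIV \<sigma> \<circ> s \<circ> \<sigma>"
  have \<rho>_perm: "\<rho> permutes {1..n}"
    unfolding \<rho>_def by (intro permutes_compose permutes_inv perm s)
  have \<sigma>\<rho>: "\<sigma> (\<rho> i) = s (\<sigma> i)" for i
    using permutes_surj[OF perm] by (simp add: \<rho>_def surj_f_inv_f)
  \<comment> \<open>Rotation symmetry of the image under \<open>\<sigma>\<close> says that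
    \<open>s\<close> fixes the image family; rewriting \<open>s\<close> after
    \<open>\<sigma>\<close> as \<open>\<sigma>\<close> after \<open>\<rho>\<close> and cancelling
    \<open>\<sigma>\<close> gives the claim.\<close>
  have fixed: "(`) \<rho> ` trans_orbit n {0, a, b} = trans_orbit n {0, a, b}"
    if ab: "\<not> [a = 0] (mod int n)" "\<not> [b = 0] (mod int n)" "\<not> [a = b] (mod int n)" for a b
  proof -
    let ?F = "trans_orbit n {0, a, b}"
    have "rotation_symmetric n (subst_vars \<sigma> (anf_of ?F))"
      using pres ab cubic_mrs_set_eq[OF n0] by (auto simp: preserves_rotation_symmetry_def)
    then have "subst_vars s (subst_vars \<sigma> (anf_of ?F)) = subst_vars \<sigma> (anf_of ?F)"
      by (simp add: rotation_symmetric_def s_def)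
    moreover have fin: "finite ((`) \<sigma> ` ?F)" "(`) \<sigma> ` ?F \<subseteq> {S. finite S}"
      using trans_orbit_finite[OF n0, of "{0, a, b}"] by auto
    ultimately have "anf_of ((`) s ` (`) \<sigma> ` ?F) = anf_of ((`) \<sigma> ` ?F)"
      by (simp add: subst_vars_trans_orbit[OF n0 perm] subst_vars_anf_of permutes_inj[OF s(1)])
    then have "(`) s ` (`) \<sigma> ` ?F = (`) \<sigma> ` ?F"
      by (subst (asm) anf_of_eq_iff) (use fin in auto)
    then have "(`) \<sigma> ` (`) \<rho> ` ?F = (`) \<sigma> ` ?F"
      by (simp add: image_image \<sigma>\<rho>)
    moreover have "inj ((`) \<sigma>)"
      using inj by (simp add: inj_on_def inj_image_eq_iff)
    ultimately show ?thesis
      by (simp add: inj_image_eq_iff)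
  qed
  \<comment> \<open>Subtracting 1 undoes the offset in \<open>pos\<close>, so \<open>r\<close>
    describes \<open>\<rho>\<close> on residues numbered from 0.\<close>
  define r where "r x = int (\<rho> (pos n x)) - 1" for x
  have pos_r: "pos n (r x) = \<rho> (pos n x)" for x
    unfolding r_def using permutes_in_image[OF \<rho>_perm] pos_in[OF n0] by (intro pos_of_nat) simp
  have r_inj: "int n dvd r x - r y \<longleftrightarrow> int n dvd x - y" for x y
    using inj_eq[OF permutes_inj[OF \<rho>_perm], of "pos n x" "pos n y"]
    by (simp add: pos_eq_iff_dvd[OF n0, symmetric] pos_r)
  have mem: "pos n ` {r t, r (a + t), r (b + t)} \<in> trans_orbit n {0, a, b}"
    if "\<not> int n dvd a" "\<not> int n dvd b" "\<not> int n dvd a - b" for a b t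
  proof -
    have "(\<lambda>x. pos n (x + t)) ` {0, a, b} \<in> trans_orbit n {0, a, b}"
      by (auto simp: trans_orbit_def)
    then have "\<rho> ` (\<lambda>x. pos n (x + t)) ` {0, a, b} \<in> trans_orbit n {0, a, b}"
      using fixed[of a b] that imageI[of _ "trans_orbit n {0, a, b}" "(`) \<rho>"]
      by (metis cong_0_iff cong_iff_dvd_diff)
    then show ?thesis by (simp add: pos_r)
  qed
  have no: "\<not> int n dvd 1" "\<not> int n dvd 2" "\<not> int n dvd 3"
    by (rule not_dvd_small[OF n]; simp)+
  have "int n dvd r x - (r 0 + x)" for x
  proof (rule translation_if_preserves_012_013[OF n])
    show "pos n ` {r t, r (t + 1), r (t + 2)} \<in> trans_orbit n {0, 1, 2}" for t
      using mem[of 1 2 t] no by (simp add: add.commute)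
    show "pos n ` {r 0, r 1, r 3} \<in> trans_orbit n {0, 1, 3}"
      using mem[of 1 3 0] no by simp
  qed (rule r_inj)
  then have \<rho>: "\<rho> (pos n x) = pos n (x + r 0)" for x
    using n0 by (simp add: pos_eq_iff_dvd add.commute flip: pos_r)
  define c where "c = r 0"
  have step: "s (\<sigma> (pos n x)) = \<sigma> (pos n (x + c))" for x
    using \<sigma>\<rho>[of "pos n x"] \<rho> by (simp add: c_def)
  obtain b where b: "\<sigma> (pos n 0) = pos n b"
    using ex_pos permutes_in_image[OF perm] pos_in[OF n0] by metis
  have line: "pos n (b + int k) = \<sigma> (pos n (c * int k))" for k
  proof (induction k)
    case (Suc k)
    have "pos n (b + int (Suc k)) = s (pos n (b + int k))"
      by (simp add: s(2) add.commute add.left_commute)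
    also have "\<dots> = \<sigma> (pos n (c * int (Suc k)))"
      by (simp add: Suc step algebra_simps)
    finally show ?case .
  qed (simp add: b)
  obtain y where y: "\<sigma> (pos n 1) = pos n y"
    using ex_pos permutes_in_image[OF perm] pos_in[OF n0] by metis
  \<comment> \<open>\<open>k\<close> counts the unit shifts from the image of residue 0 to that of
    residue 1, so \<open>c * k\<close> is 1 modulo \<open>n\<close> and \<open>k\<close> is the
    slope.\<close>
  define k where "k = nat ((y - b) mod int n)"
  have "[b + int k = b + (y - b)] (mod int n)"
    unfolding k_def using n0 by (intro cong_add cong_refl) (simp add: cong_def)
  then have "\<sigma> (pos n (c * int k)) = \<sigma> (pos n 1)"
    using y line[of k] pos_eq_iff[OF n0, of "b + int k" y] by simp
  then have ck: "[c * int k = 1] (mod int n)"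
    using inj n0 by (simp add: inj_eq pos_eq_iff)
  show ?thesis
  proof
    show "coprime (int k) (int n)"
      using ck by (metis coprime_iff_invertible_int mult.commute)
    fix x
    define m where "m = nat (x mod int n)"
    have m: "[int m = x] (mod int n)"
      unfolding m_def using n0 by (simp add: cong_def)
    have "[c * int (k * m) = x] (mod int n)"
      using cong_mult[OF ck m] by (simp add: mult.assoc)
    then have "\<sigma> (pos n x) = pos n (b + int (k * m))"
      using line[of "k * m"] n0 by (metis pos_eq_iff)
    also have "[b + int (k * m) = int k * x + b] (mod int n)"
      using cong_add[OF cong_mult[OF cong_refl[of "int k"] m] cong_refl[of b]]
      by (simp add: add.commute)
    then have "pos n (b + int (k * m)) = pos n (int k * x + b)"
      using n0 by (simp add: pos_eq_iff)
    finally show "\<sigma> (pos n x) = pos n (int k * x + b)" .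
  qed
qed

section \<open>The group and its orbits\<close>

lemma sigma_perm_eq_iff:
  assumes "n > 0"
  shows "sigma_perm \<tau> n = sigma_perm \<kappa> n \<longleftrightarrow> [\<tau> = \<kappa>] (mod int n)"
proof
  assume "sigma_perm \<tau> n = sigma_perm \<kappa> n"
  then have "sigma_perm \<tau> n (pos n 1) = sigma_perm \<kappa> n (pos n 1)" by simp
  then show "[\<tau> = \<kappa>] (mod int n)"
    using assms by (simp add: sigma_perm_pos pos_eq_iff)
next
  assume *: "[\<tau> = \<kappa>] (mod int n)"
  show "sigma_perm \<tau> n = sigma_perm \<kappa> n"
  proof
    fix i
    show "sigma_perm \<tau> n i = sigma_perm \<kappa> n i"
    proof (cases "i \<in> {1..n}")
      case True
      then obtain x where "i = pos n x" by (rule ex_pos)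
      then show ?thesis
        using assms * by (simp add: sigma_perm_pos pos_eq_iff cong_scalar_right)
    next
      case False
      then show ?thesis unfolding sigma_perm_def by (simp only: if_False)
    qed
  qed
qed

lemma sigma_perm_comp:
  assumes "n > 0"
  shows "sigma_perm \<tau> n \<circ> sigma_perm \<kappa> n = sigma_perm (\<tau> * \<kappa>) n"
proof
  fix i
  show "(sigma_perm \<tau> n \<circ> sigma_perm \<kappa> n) i = sigma_perm (\<tau> * \<kappa>) n i"
  proof (cases "i \<in> {1..n}")
    case True
    then obtain x where "i = pos n x" by (rule ex_pos)
    then show ?thesis
      using assms by (simp add: sigma_perm_pos mult.assoc)
  next
    case False
    then show ?thesis unfolding sigma_perm_def comp_def by (simp only: if_False)
  qed
qed

lemma sigma_perm_1:
  assumes "n > 0"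
  shows "sigma_perm 1 n = id"
proof
  fix i
  show "sigma_perm 1 n i = id i"
  proof (cases "i \<in> {1..n}")
    case True
    then obtain x where "i = pos n x" by (rule ex_pos)
    then show ?thesis
      using assms by (simp add: sigma_perm_pos)
  next
    case False
    then show ?thesis unfolding sigma_perm_def id_def by (simp only: if_False)
  qed
qed

lemma inv_sigma_perm:
  assumes n: "n > 0" and \<tau>: "coprime \<tau> (int n)" and \<tau>\<kappa>: "[\<tau> * \<kappa> = 1] (mod int n)"
  shows "inv\<^bsub>sym_group n\<^esub> (sigma_perm \<tau> n) = sigma_perm \<kappa> n" and "coprime \<kappa> (int n)"
proof -
  show co: "coprime \<kappa> (int n)"
    using \<tau>\<kappa> by (metis coprime_iff_invertible_int mult.commute)
  have "sigma_perm \<kappa> n \<circ> sigma_perm \<tau> n = id"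
    unfolding sigma_perm_comp[OF n] sigma_perm_1[OF n, symmetric]
    using \<tau>\<kappa> n by (simp add: sigma_perm_eq_iff mult.commute)
  then show "inv\<^bsub>sym_group n\<^esub> (sigma_perm \<tau> n) = sigma_perm \<kappa> n"
    using \<tau> co sigma_perm_permutes[OF n]
    by (intro group.inv_equality[OF sym_group_is_group])
      (simp_all only: sym_group_carrier sym_group_mult sym_group_one)
qed

lemma subgroup_sigma_group:
  assumes "n > 0"
  shows "subgroup (sigma_group n) (sym_group n)"
proof (rule group.subgroupI[OF sym_group_is_group])
  show "sigma_group n \<subseteq> carrier (sym_group n)"
    using sigma_perm_permutes[OF assms] by (auto simp: sigma_group_def sym_group_carrier)
  show "sigma_group n \<noteq> {}"
    using coprime_1_left[of "int n"] unfolding sigma_group_def by blast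
next
  fix p assume "p \<in> sigma_group n"
  then obtain \<tau> where \<tau>: "p = sigma_perm \<tau> n" "coprime \<tau> (int n)"
    by (auto simp: sigma_group_def)
  obtain \<kappa> where \<kappa>: "[\<tau> * \<kappa> = 1] (mod int n)"
    using \<tau>(2) cong_solve_coprime_int by blast
  then show "inv\<^bsub>sym_group n\<^esub> p \<in> sigma_group n"
    using inv_sigma_perm[OF assms \<tau>(2)] \<tau>(1) by (auto simp: sigma_group_def)
next
  fix p q assume "p \<in> sigma_group n" "q \<in> sigma_group n"
  then obtain \<tau> \<kappa> where *: "p = sigma_perm \<tau> n" "q = sigma_perm \<kappa> n"
    "coprime \<tau> (int n)" "coprime \<kappa> (int n)"
    by (auto simp: sigma_group_def)
  then have "coprime (\<tau> * \<kappa>) (int n)" by simp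
  then show "p \<otimes>\<^bsub>sym_group n\<^esub> q \<in> sigma_group n"
    unfolding * sym_group_mult sigma_perm_comp[OF assms] sigma_group_def by blast
qed

text \<open>\<open>sigma_perm\<close> depends exactly on the residue class of its slope, and
  \<open>totatives n\<close> represents each class of units once.\<close>

lemma card_sigma_group:
  assumes "n > 1"
  shows "card (sigma_group n) = totient n"
proof -
  have n0: "n > 0" using assms by simp
  have "sigma_group n = (\<lambda>k. sigma_perm (int k) n) ` totatives n"
  proof (intro subset_antisym subsetI)
    fix p assume "p \<in> sigma_group n"
    then obtain \<tau> where \<tau>: "p = sigma_perm \<tau> n" "coprime \<tau> (int n)"
      by (auto simp: sigma_group_def)
    define k where "k = nat (\<tau> mod int n)"
    have k: "int k = \<tau> mod int n" "k < n"
      using n0 by (simp_all add: k_def nat_less_iff)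
    then have "[int k = \<tau>] (mod int n)"
      by (simp add: cong_def)
    moreover from this have "coprime (int k) (int n)"
      using \<tau>(2) cong_imp_coprime cong_sym by blast
    then have "coprime k n" by simp
    moreover from this have "k > 0"
      using assms by (cases "k = 0") auto
    ultimately show "p \<in> (\<lambda>k. sigma_perm (int k) n) ` totatives n"
      using \<tau>(1) k(2) n0 by (intro image_eqI[of _ _ k]) (auto simp: sigma_perm_eq_iff in_totatives_iff cong_sym_eq)
  next
    fix p assume "p \<in> (\<lambda>k. sigma_perm (int k) n) ` totatives n"
    then show "p \<in> sigma_group n"
      by (auto simp: sigma_group_def in_totatives_iff)
  qed
  moreover have "inj_on (\<lambda>k. sigma_perm (int k) n) (totatives n)"
  proof (rule inj_onI)
    fix k l assume *: "k \<in> totatives n" "l \<in> totatives n" "sigma_perm (int k) n = sigma_perm (int l) n"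
    then have "[k = l] (mod n)"
      using n0 by (simp add: sigma_perm_eq_iff cong_int_iff)
    moreover have "k < n" "l < n"
      using * assms totatives_less by blast+
    ultimately show "k = l"
      by (simp add: cong_less_modulus_unique_nat)
  qed
  ultimately show ?thesis
    by (simp add: card_image totient_def)
qed

section \<open>Group orbits as equivalence classes\<close>

lemma mrs_orbits_eq: "mrs_orbits n H = (\<lambda>f. (\<lambda>\<sigma>. subst_vars \<sigma> f) ` H) ` cubic_mrs_set n"
  by (auto simp: mrs_orbits_def orbits_def orbit_def)

lemma sigma_perm_closed:
  assumes n: "n > 0" and \<tau>: "coprime \<tau> (int n)" and f: "f \<in> cubic_mrs_set n"
  shows "subst_vars (sigma_perm \<tau> n) f \<in> cubic_mrs_set n"
proof -
  obtain a b where ab: "f = anf_of (trans_orbit n {0, a, b})"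
    "\<not> [a = 0] (mod int n)" "\<not> [b = 0] (mod int n)" "\<not> [a = b] (mod int n)"
    using f cubic_mrs_set_eq[OF n] by blast
  have "subst_vars (sigma_perm \<tau> n) f = anf_of (trans_orbit n {0, \<tau> * a, \<tau> * b})"
    using subst_sigma_perm[OF n \<tau>] by (simp add: ab(1))
  moreover have "\<not> [\<tau> * a = 0] (mod int n)" "\<not> [\<tau> * b = 0] (mod int n)" "\<not> [\<tau> * a = \<tau> * b] (mod int n)"
    using ab(2-4) cong_mult_lcancel[OF \<tau>, of a 0] cong_mult_lcancel[OF \<tau>, of b 0]
      cong_mult_lcancel[OF \<tau>, of a b] by auto
  ultimately show ?thesis
    using cubic_mrs_set_eq[OF n] by blast
qed

text \<open>A preserving permutation is affine and acts on \<open>f\<close> through its slope alone.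
  Conversely each \<open>sigma_perm\<close> with unit slope maps cubic MRS functions to cubic MRS
  functions, which are rotation symmetric.\<close>

lemma mrs_equivalence_image:
  assumes n: "n \<ge> 6" and f: "f \<in> cubic_mrs_set n"
  shows "mrs_equivalence n `` {f} = (\<lambda>\<sigma>. subst_vars \<sigma> f) ` sigma_group n"
proof (intro subset_antisym subsetI)
  have n0: "n > 0" using n by simp
  fix g assume "g \<in> mrs_equivalence n `` {f}"
  then obtain \<sigma> where \<sigma>: "preserves_rotation_symmetry n \<sigma>" "g = subst_vars \<sigma> f"
    by (auto simp: mrs_equivalence_def)
  obtain \<tau> b where \<tau>: "coprime \<tau> (int n)" "\<And>x. \<sigma> (pos n x) = pos n (\<tau> * x + b)"
    using preserves_imp_affine[OF n \<sigma>(1)] by metis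
  obtain A where "f = anf_of (trans_orbit n A)"
    using f cubic_mrs_set_eq[OF n0] by auto
  moreover have "\<sigma> permutes {1..n}"
    using \<sigma>(1) by (simp add: preserves_rotation_symmetry_def)
  ultimately have "g = subst_vars (sigma_perm \<tau> n) f"
    using \<sigma>(2) subst_vars_affine[OF n0 _ \<tau>(2) \<tau>(1)] subst_sigma_perm[OF n0 \<tau>(1)] by metis
  then show "g \<in> (\<lambda>\<sigma>. subst_vars \<sigma> f) ` sigma_group n"
    using \<tau>(1) by (auto simp: sigma_group_def)
next
  have n0: "n > 0" using n by simp
  fix g assume "g \<in> (\<lambda>\<sigma>. subst_vars \<sigma> f) ` sigma_group n"
  then obtain \<tau> where \<tau>: "coprime \<tau> (int n)" "g = subst_vars (sigma_perm \<tau> n) f"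
    by (auto simp: sigma_group_def)
  have "rotation_symmetric n h" if "h \<in> cubic_mrs_set n" for h
    using that cubic_mrs_set_eq[OF n0] rotation_symmetric_trans_orbit[OF n0] by auto
  then have "preserves_rotation_symmetry n (sigma_perm \<tau> n)"
    using sigma_perm_closed[OF n0 \<tau>(1)] sigma_perm_permutes[OF n0 \<tau>(1)]
    by (simp only: preserves_rotation_symmetry_def) blast
  then show "g \<in> mrs_equivalence n `` {f}"
    using f \<tau> sigma_perm_closed[OF n0 \<tau>(1) f] by (auto simp: mrs_equivalence_def)
qed

lemma mrs_orbits_sigma_group:
  "n \<ge> 6 \<Longrightarrow> mrs_orbits n (sigma_group n) = cubic_mrs_set n // mrs_equivalence n"
  by (auto simp: mrs_orbits_eq quotient_def mrs_equivalence_image)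

section \<open>Minimality of the group\<close>

lemma trans_orbit_cong:
  assumes "n > 0" "[\<tau> = \<kappa>] (mod int n)"
  shows "trans_orbit n ((*) \<tau> ` A) = trans_orbit n ((*) \<kappa> ` A)"
proof -
  have "pos n (\<tau> * x + t) = pos n (\<kappa> * x + t)" for x t
    using assms by (simp add: pos_eq_iff cong_add_rcancel cong_scalar_right)
  then show ?thesis
    by (simp add: trans_orbit_def image_image)
qed

lemma sigma_group_minimal:
  assumes n: "n \<ge> 6" and H: "subgroup H (sym_group n)" "H \<subseteq> sigma_group n"
    and orbits: "mrs_orbits n H = mrs_orbits n (sigma_group n)"
  shows "H = sigma_group n"
proof (rule ccontr)
  assume "H \<noteq> sigma_group n"
  have n0: "n > 0" using n by simp
  \<comment> \<open>\<open>K\<close> collects all integer slopes of members of \<open>H\<close>,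
    turning composition into commutative multiplication modulo \<open>n\<close>.\<close>
  define K where "K = {\<tau>. coprime \<tau> (int n) \<and> sigma_perm \<tau> n \<in> H}"
  have K_one: "1 \<in> K"
    using subgroup.one_closed[OF H(1)] by (simp add: K_def sigma_perm_1[OF n0] sym_group_one)
  have K_mult: "\<tau> * \<kappa> \<in> K" if "\<tau> \<in> K" "\<kappa> \<in> K" for \<tau> \<kappa>
    using that subgroup.m_closed[OF H(1), of "sigma_perm \<tau> n" "sigma_perm \<kappa> n"]
    by (simp add: K_def sym_group_mult sigma_perm_comp[OF n0])
  have K_cong: "\<kappa> \<in> K" if "[\<tau> = \<kappa>] (mod int n)" "\<tau> \<in> K" for \<tau> \<kappa>
    using that cong_imp_coprime sigma_perm_eq_iff[OF n0, of \<tau> \<kappa>] by (auto simp: K_def)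
  have K_inv: "\<kappa> \<in> K" if "[\<tau> * \<kappa> = 1] (mod int n)" "\<tau> \<in> K" for \<tau> \<kappa>
    using that subgroup.m_inv_closed[OF H(1), of "sigma_perm \<tau> n"] inv_sigma_perm[OF n0 _ that(1)]
    by (simp add: K_def)
  have factor: "\<exists>h\<in>K. \<exists>\<kappa>. coprime \<kappa> (int n) \<and> [h * \<kappa> = \<tau>] (mod int n) \<and>
      trans_orbit n ((*) \<kappa> ` {0, a, b}) = trans_orbit n {0, a, b}"
    if \<tau>: "coprime \<tau> (int n)" and ab: "\<not> int n dvd a" "\<not> int n dvd b" "\<not> int n dvd b - a" for \<tau> a b
  proof -
    let ?A = "{0, a, b}"
    let ?f = "anf_of (trans_orbit n ?A)"
    have "\<not> int n dvd a - b"
      using ab(3) by (simp add: dvd_diff_commute)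
    then have f: "?f \<in> cubic_mrs_set n"
      using ab cubic_mrs_set_eq[OF n0] by (auto simp: cong_iff_dvd_diff)
    then have "(\<lambda>\<sigma>. subst_vars \<sigma> ?f) ` sigma_group n \<in> mrs_orbits n H"
      unfolding orbits by (auto simp: mrs_orbits_eq)
    \<comment> \<open>Equality of the partitions gives only some \<open>f'\<close> with this
      \<open>H\<close>-orbit; both \<open>?f\<close> and its image under \<open>\<tau>\<close> are
      therefore expressed through \<open>f'\<close>.\<close>
    then obtain f' where f': "f' \<in> cubic_mrs_set n"
      "(\<lambda>\<sigma>. subst_vars \<sigma> ?f) ` sigma_group n = (\<lambda>\<sigma>. subst_vars \<sigma> f') ` H"
      by (auto simp: mrs_orbits_eq)
    obtain B where B: "f' = anf_of (trans_orbit n B)"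
      using f'(1) cubic_mrs_set_eq[OF n0] by auto
    have ex: "\<exists>h\<in>K. trans_orbit n ((*) \<mu> ` ?A) = trans_orbit n ((*) h ` B)"
      if \<mu>: "coprime \<mu> (int n)" for \<mu>
    proof -
      have "subst_vars (sigma_perm \<mu> n) ?f \<in> (\<lambda>\<sigma>. subst_vars \<sigma> f') ` H"
        unfolding f'(2)[symmetric] using \<mu> by (auto simp: sigma_group_def)
      then obtain p where p: "p \<in> H" "subst_vars (sigma_perm \<mu> n) ?f = subst_vars p f'" by blast
      then obtain h where h: "p = sigma_perm h n" "coprime h (int n)"
        using H(2) by (auto simp: sigma_group_def)
      then have "h \<in> K" using p by (simp add: K_def)
      moreover have "anf_of (trans_orbit n ((*) \<mu> ` ?A)) = anf_of (trans_orbit n ((*) h ` B))"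
        using p(2) h B subst_sigma_perm[OF n0] \<mu> by metis
      ultimately show ?thesis
        using anf_of_trans_orbit_eq_iff[OF n0] by blast
    qed
    obtain h1 where h1: "h1 \<in> K" "trans_orbit n ((*) 1 ` ?A) = trans_orbit n ((*) h1 ` B)"
      using ex[of 1] by auto
    obtain h2 where h2: "h2 \<in> K" "trans_orbit n ((*) \<tau> ` ?A) = trans_orbit n ((*) h2 ` B)"
      using ex[OF \<tau>] by auto
    obtain g where g: "[h2 * g = 1] (mod int n)"
      using h2(1) cong_solve_coprime_int[of h2 "int n"] by (auto simp: K_def)
    have gK: "g \<in> K" using K_inv[OF g h2(1)] .
    have scale: "trans_orbit n ((*) (m * k) ` C) = trans_orbit n ((*) (m * l) ` D)"
      if "coprime m (int n)" "trans_orbit n ((*) k ` C) = trans_orbit n ((*) l ` D)" for m k l C D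
    proof -
      have "(`) (sigma_perm m n) ` trans_orbit n ((*) k ` C) = trans_orbit n ((*) (m * k) ` C)" for k C
        using image_trans_orbit[OF n0, of "sigma_perm m n" m 0] that(1)
        by (simp add: sigma_perm_pos[OF n0] image_image mult.assoc)
      then show ?thesis using that(2) by metis
    qed
    \<comment> \<open>With \<open>g\<close> inverse to \<open>h2\<close>, \<open>h1 * g\<close>
      takes the orbit of \<open>\<tau>\<close> times \<open>?A\<close> back to that of
      \<open>?A\<close>. So \<open>h1 * g * \<tau>\<close> is the stabilizer factor and the inverse
      of \<open>h1 * g\<close> the factor in \<open>K\<close>.\<close>
    have "h1 * g \<in> K" using K_mult h1(1) gK by blast
    have co: "coprime (h1 * g) (int n)"
      using \<open>h1 * g \<in> K\<close> by (simp add: K_def)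
    have "trans_orbit n ((*) (h1 * g * \<tau>) ` ?A) = trans_orbit n ((*) (h1 * g * h2) ` B)"
      by (rule scale[OF co h2(2)])
    also have "\<dots> = trans_orbit n ((*) h1 ` B)"
      using cong_mult[OF cong_refl[of h1] g] by (intro trans_orbit_cong[OF n0]) (simp add: ac_simps)
    also have "\<dots> = trans_orbit n ?A"
      using h1(2) by simp
    finally have stab: "trans_orbit n ((*) (h1 * g * \<tau>) ` ?A) = trans_orbit n ?A" .
    obtain h where h: "[(h1 * g) * h = 1] (mod int n)"
      using co cong_solve_coprime_int by blast
    have "h \<in> K" using K_inv[OF h \<open>h1 * g \<in> K\<close>] .
    moreover have "[h * (h1 * g * \<tau>) = \<tau>] (mod int n)"
      using cong_mult[OF h cong_refl[of \<tau>]] by (simp add: ac_simps)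
    moreover have "coprime (h1 * g * \<tau>) (int n)"
      using co \<tau> by simp
    ultimately show ?thesis using stab by blast
  qed
  have no: "\<not> int n dvd 1" "\<not> int n dvd 2" "\<not> int n dvd 3" "\<not> int n dvd 4"
    by (rule not_dvd_small[OF n]; simp)+
  obtain \<tau> where \<tau>: "coprime \<tau> (int n)" "\<tau> \<notin> K"
    using \<open>H \<noteq> sigma_group n\<close> H(2) by (auto simp: sigma_group_def K_def)
  \<comment> \<open>Otherwise the stabilizer of the orbit of \<open>{0, 1, 2}\<close> lies in
    \<open>K\<close>, hence so do both factors of \<open>\<tau>\<close>.\<close>
  have neg1: "-1 \<notin> K"
  proof
    assume "-1 \<in> K"
    obtain h \<kappa> where *: "h \<in> K" "coprime \<kappa> (int n)" "[h * \<kappa> = \<tau>] (mod int n)"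
      "trans_orbit n ((*) \<kappa> ` {0, 1, 2}) = trans_orbit n {0, 1, 2}"
      using factor[OF \<tau>(1), of 1 2] no by auto
    have "\<kappa> \<in> K"
      using stabilizer_012[OF n *(2) *(4)] K_cong K_one \<open>-1 \<in> K\<close> cong_sym by blast
    then show False
      using K_cong[OF *(3)] K_mult *(1) \<tau>(2) by blast
  qed
  \<comment> \<open>A stabilizer factor inside \<open>K\<close> would put the product
    \<open>-1\<close> into \<open>K\<close>.\<close>
  have factor_neg1: "\<exists>h\<in>K. \<exists>\<kappa>. \<kappa> \<notin> K \<and> coprime \<kappa> (int n) \<and> [h * \<kappa> = -1] (mod int n) \<and>
      trans_orbit n ((*) \<kappa> ` {0, a, b}) = trans_orbit n {0, a, b}"
    if "\<not> int n dvd a" "\<not> int n dvd b" "\<not> int n dvd b - a" for a b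
    using factor[of "-1" a b] that K_cong K_mult neg1 by (metis coprime_1_left coprime_minus_left_iff)
  obtain h \<kappa> where *: "h \<in> K" "\<kappa> \<notin> K" "coprime \<kappa> (int n)" "[h * \<kappa> = -1] (mod int n)"
    "trans_orbit n ((*) \<kappa> ` {0, 1, 3}) = trans_orbit n {0, 1, 3}"
    using factor_neg1[of 1 3] no by auto
  from stabilizer_013[OF n *(3,5)] show False
  proof (elim disjE conjE)
    assume "[\<kappa> = 1] (mod int n)"
    then show False using *(2) K_cong K_one cong_sym by blast
  next
    \<comment> \<open>Cubing removes \<open>\<kappa>\<close> and, 3 being odd, keeps
      \<open>-1\<close>, so \<open>h ^ 3\<close> puts \<open>-1\<close> into
      \<open>K\<close>.\<close>
    assume \<kappa>: "[\<kappa> ^ 3 = 1] (mod int n)"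
    have "[(h * \<kappa>) ^ 3 = (-1) ^ 3] (mod int n)"
      using *(4) by (rule cong_pow)
    moreover have "[(h * \<kappa>) ^ 3 = h ^ 3] (mod int n)"
      using cong_mult[OF cong_refl[of "h ^ 3"] \<kappa>] by (simp add: power_mult_distrib)
    ultimately have "[h ^ 3 = -1] (mod int n)"
      by (simp add: cong_def)
    moreover have "h ^ 3 \<in> K"
      using K_mult *(1) by (simp add: power3_eq_cube)
    ultimately show False using K_cong neg1 by blast
  next
    assume n8: "n = 8" and \<kappa>: "[\<kappa> = 3] (mod 8)"
    have "[h * 3 = -1] (mod 8)"
      using *(4) cong_mult[OF cong_refl[of h] \<kappa>] n8 by (simp add: cong_def)
    \<comment> \<open>3 is its own inverse modulo 8, so \<open>h\<close> is congruent to
      \<open>-3\<close>.\<close>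
    then have "[h = 5] (mod 8)"
      unfolding cong_iff_dvd_diff by presburger
    then have K5: "5 \<in> K" using K_cong *(1) n8 by simp
    \<comment> \<open>Now 1 and 5 are in \<open>K\<close>, yet factoring \<open>-1\<close> over the
      orbit of \<open>{0, 1, 4}\<close> yields a stabilizer element outside
      \<open>K\<close>.\<close>
    obtain \<mu> where \<mu>: "\<mu> \<notin> K" "coprime \<mu> (int n)"
      "trans_orbit n ((*) \<mu> ` {0, 1, 4}) = trans_orbit n {0, 1, 4}"
      using factor_neg1[of 1 4] no by auto
    then have "[\<mu> = 1] (mod 8) \<or> [\<mu> = 5] (mod 8)"
      using stabilizer_014 n8 by simp
    then have "[1 = \<mu>] (mod int n) \<or> [5 = \<mu>] (mod int n)"
      using n8 by (simp add: cong_sym_eq)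
    then show False using \<mu>(1) K_cong K_one K5 by blast
  qed
qed

theorem theorem3p11:
  fixes n :: nat
  assumes "n \<ge> 6"
  shows "subgroup (sigma_group n) (sym_group n) \<and>
    card (sigma_group n) = totient n \<and>
    mrs_orbits n (sigma_group n) = cubic_mrs_set n // mrs_equivalence n \<and>
    (\<forall>H. subgroup H (sym_group n) \<and> H \<subseteq> sigma_group n \<and> card H < totient n \<longrightarrow>
       mrs_orbits n H \<noteq> cubic_mrs_set n // mrs_equivalence n)"
proof (intro conjI allI impI)
  show "subgroup (sigma_group n) (sym_group n)" "card (sigma_group n) = totient n"
    using assms by (simp_all add: subgroup_sigma_group card_sigma_group)
  show orbits: "mrs_orbits n (sigma_group n) = cubic_mrs_set n // mrs_equivalence n"
    using assms by (rule mrs_orbits_sigma_group)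
  fix H assume H: "subgroup H (sym_group n) \<and> H \<subseteq> sigma_group n \<and> card H < totient n"
  then have "H \<noteq> sigma_group n"
    using \<open>card (sigma_group n) = totient n\<close> by auto
  then show "mrs_orbits n H \<noteq> cubic_mrs_set n // mrs_equivalence n"
    using sigma_group_minimal[OF assms] H orbits by metis
qed

end
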